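(* Let $M$ be a real Hilbert space and let $G$ be a group acting linearly on $M$. Let $t_0\in M$, $t_0\ne 0$, and suppose that its orbit is bounded, with constants $a\ge0$, $A>0$ such that $a\|t_0\|\le\|g\cdot t_0\|\le A\|t_0\|$ for all $g\in G$. Suppose that $A<\sqrt2$. Let $Y=\Phi\cdot t_0+\sigma\epsilon$ with $\sigma>0$, $\Phi$ a random element of $G$ and $\epsilon$ a standardized noise in $M$ independent of $\Phi$. Suppose also that $$\theta(t_0)=\frac1{\|t_0\|}\mathbb{E}\Big(\sup_{g\in G}\langle g\cdot t_0,\epsilon\rangle\Big)>0.$$ Then there is inconsistency, i.e. $t_0$ is not a minimizer over $M$ of the pre-variance $F(m)=\mathbb{E}\big(\inf_{g\in G}\|g\cdot m-Y\|^2\big)$, as soon as $$\sigma\ge\sigma_c=\frac{\|t_0\|}{\theta(t_0)}\left[A^2+\frac{1+\sqrt{1-a^2(2-A^2)}}{2-A^2}\right].$$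
   Context: $G$ acts linearly on $M$ if for each $g\in G$ the map $x\mapsto g\cdot x$ is linear (it need not preserve the norm). A standardized noise is an $M$-valued random variable $\epsilon$ with $\mathbb{E}(\epsilon)=0$ and $\mathbb{E}(\|\epsilon\|^2)=1$. It is assumed that $\mathbb{E}(\|Y\|^2)<+\infty$. Estimation is consistent if $t_0$ minimizes $F$, and inconsistent otherwise. *)

theory Defs
  imports "HOL-Algebra.Group_Action" "HOL-Probability.Probability"
begin

definition linear_group_action ::
    "('g, 'b) monoid_scheme \<Rightarrow> ('g \<Rightarrow> 'm::real_vector \<Rightarrow> 'm) \<Rightarrow> bool" where
  "linear_group_action G act \<longleftrightarrow>
     group_action G UNIV act \<and> (\<forall>g\<in>carrier G. linear (act g))"

text \<open>The library restricts \<^const>\<open>has_bochner_integral\<close> to second-countable (that is, separable)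
  target spaces. The following is the same notion, clause by clause, without that restriction, so
  that Hilbert spaces need not be separable.\<close>

definition has_bochner_mean :: "'w measure \<Rightarrow> ('w \<Rightarrow> 'm::real_normed_vector) \<Rightarrow> 'm \<Rightarrow> bool" where
  "has_bochner_mean P X \<mu> \<longleftrightarrow>
     X \<in> borel_measurable P \<and>
     (\<exists>s. (\<forall>i. Bochner_Integration.simple_bochner_integrable P (s i)) \<and>
          (\<lambda>i::nat. \<integral>\<^sup>+\<omega>. ennreal (norm (X \<omega> - s i \<omega>)) \<partial>P) \<longlonglongrightarrow> 0 \<and>
          (\<lambda>i. Bochner_Integration.simple_bochner_integral P (s i)) \<longlonglongrightarrow> \<mu>)"

lemma has_bochner_mean_iff:
  fixes X :: "'w \<Rightarrow> 'm::{real_normed_vector, second_countable_topology}"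
  shows "has_bochner_mean P X \<mu> \<longleftrightarrow> has_bochner_integral P X \<mu>"
  unfolding has_bochner_mean_def has_bochner_integral.simps by auto

text \<open>The second moment being 1, not 0, excludes the default value that
  \<^const>\<open>lebesgue_integral\<close> takes on non-integrable functions.\<close>

definition standardized_noise :: "'w measure \<Rightarrow> ('w \<Rightarrow> 'm::real_normed_vector) \<Rightarrow> bool" where
  "standardized_noise P \<epsilon> \<longleftrightarrow>
     has_bochner_mean P \<epsilon> 0 \<and> (\<integral>\<omega>. (norm (\<epsilon> \<omega>))\<^sup>2 \<partial>P) = 1"

text \<open>The library's \<^const>\<open>prob_space.indep_var\<close> needs both variables to have the same value type.\<close>

definition indep_rvs ::
    "'w measure \<Rightarrow> 'a measure \<Rightarrow> ('w \<Rightarrow> 'a) \<Rightarrow> 'b measure \<Rightarrow> ('w \<Rightarrow> 'b) \<Rightarrow> bool" where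
  "indep_rvs P S X T Z \<longleftrightarrow>
     X \<in> measurable P S \<and> Z \<in> measurable P T \<and>
     prob_space.indep_set P {X -` A \<inter> space P |A. A \<in> sets S} {Z -` B \<inter> space P |B. B \<in> sets T}"

text \<open>The infimum is over a nonempty set of nonnegative reals. The integrand is at most
  \<open>(norm (m - Y \<omega>))\<^sup>2\<close> and upper semicontinuous in \<open>Y \<omega>\<close>, so it is integrable for every \<open>m\<close>
  when \<open>Y\<close> is Borel with finite second moment.\<close>

definition pre_variance ::
    "'w measure \<Rightarrow> ('g, 'b) monoid_scheme \<Rightarrow> ('g \<Rightarrow> 'm::real_normed_vector \<Rightarrow> 'm) \<Rightarrow> ('w \<Rightarrow> 'm) \<Rightarrow> 'm \<Rightarrow> real"
  where
  "pre_variance P G act Y m = (\<integral>\<omega>. (INF g\<in>carrier G. (norm (act g m - Y \<omega>))\<^sup>2) \<partial>P)"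

definition theta ::
    "'w measure \<Rightarrow> ('g, 'b) monoid_scheme \<Rightarrow> ('g \<Rightarrow> 'm::real_inner \<Rightarrow> 'm) \<Rightarrow> ('w \<Rightarrow> 'm) \<Rightarrow> 'm \<Rightarrow> real"
  where
  "theta P G act \<epsilon> t = (1 / norm t) * (\<integral>\<omega>. (SUP g\<in>carrier G. act g t \<bullet> \<epsilon> \<omega>) \<partial>P)"

definition consistent ::
    "'w measure \<Rightarrow> ('g, 'b) monoid_scheme \<Rightarrow> ('g \<Rightarrow> 'm::real_normed_vector \<Rightarrow> 'm) \<Rightarrow> ('w \<Rightarrow> 'm) \<Rightarrow> 'm \<Rightarrow> bool"
  where
  "consistent P G act Y t \<longleftrightarrow> (\<forall>m. pre_variance P G act Y t \<le> pre_variance P G act Y m)"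

end

theory Submission
  imports Defs
begin

text \<open>
  Write \<open>C\<close> for the orbit of \<open>t0\<close>, \<open>R = A * norm t0\<close>, \<open>x = (norm t0)\<^sup>2\<close>, and \<open>h y\<close> for the supremum
  of \<open>z \<bullet> y\<close> over \<open>z \<in> C\<close>. The claim is that some multiple of \<open>t0\<close> has a smaller pre-variance than
  \<open>t0\<close> itself. Expanding the squared norm, and using that the action is linear, the bounds on the
  orbit give, with \<open>E\<close> for the expectation and for every \<open>l \<ge> 0\<close>,

  \<^item> \<open>F (l *\<^sub>R t0) \<le> E ((norm Y)\<^sup>2) + l\<^sup>2 * A\<^sup>2 * x - 2 * l * E (h Y)\<close>
    (lemma \<open>INF_dist_sq_scaled_le\<close>),
  \<^item> \<open>F t0 \<ge> E ((norm Y)\<^sup>2) + a\<^sup>2 * x - 2 * E (h Y)\<close> (lemma \<open>INF_dist_sq_ge\<close>).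

  Put \<open>s = E (h Y) / x\<close> and take \<open>l = s\<close>. Then \<open>F (s *\<^sub>R t0) - F t0\<close> is at most
  \<open>- x * ((2 - A\<^sup>2) * s\<^sup>2 - 2 * s + a\<^sup>2)\<close>, which is negative once \<open>s\<close> exceeds the larger root \<open>r\<close> of
  this quadratic; and \<open>r\<close> is the fraction in the definition of the critical noise level.

  It remains to see that \<open>s > r\<close>. Since \<open>z \<bullet> (\<Phi> \<cdot> t0) \<ge> - R\<^sup>2\<close> on the orbit, pointwise
  \<open>h Y \<ge> \<sigma> * h \<epsilon> - R\<^sup>2\<close>, and so \<open>E (h Y) \<ge> \<sigma> * theta * norm t0 - A\<^sup>2 * x\<close>, which is at least \<open>r * x\<close>
  by the hypothesis on \<open>\<sigma>\<close>. The lower bound for \<open>E (h Y)\<close> is in fact strict, which matters when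
  \<open>\<sigma>\<close> is exactly critical: in case of equality, almost surely the near-maximizers of \<open>z \<bullet> \<epsilon>\<close> lie close to
  \<open>- (\<Phi> \<cdot> t0)\<close>, so that \<open>h \<epsilon> \<le> - ((\<Phi> \<cdot> t0) \<bullet> \<epsilon>)\<close> (lemma \<open>support_fun_shift_equality_case\<close>). By
  independence the right-hand side has mean zero (lemma \<open>expectation_inner_indep\<close>), whereas
  \<open>E (h \<epsilon>) = theta * norm t0\<close> is positive.

  In a nonseparable space the inner product need not be measurable for the product of the Borel
  \<sigma>-algebras, so Fubini's theorem is not directly applicable to it. What rescues the independence
  argument is that a Bochner integrable variable takes almost all its values in a separable set
  (lemma \<open>has_bochner_mean_separably_valued\<close>).
\<close>

section \<open>Support functions and distances to bounded sets\<close>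

definition support_fun :: "'m::real_inner set \<Rightarrow> 'm \<Rightarrow> real" where
  "support_fun C y = (SUP z\<in>C. z \<bullet> y)"

lemma bdd_above_inner_image:
  fixes C :: "'m::real_inner set"
  assumes "\<And>z. z \<in> C \<Longrightarrow> norm z \<le> R"
  shows "bdd_above ((\<lambda>z. z \<bullet> y) ` C)"
proof (rule bdd_aboveI2)
  fix z assume "z \<in> C"
  have "z \<bullet> y \<le> norm z * norm y" by (rule norm_cauchy_schwarz)
  also have "\<dots> \<le> R * norm y" by (intro mult_right_mono assms \<open>z \<in> C\<close>) simp
  finally show "z \<bullet> y \<le> R * norm y" .
qed

lemma inner_le_support_fun:
  assumes "\<And>z. z \<in> C \<Longrightarrow> norm z \<le> R" and "z \<in> C"
  shows "z \<bullet> y \<le> support_fun C y"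
  unfolding support_fun_def by (rule cSUP_upper[OF assms(2) bdd_above_inner_image[OF assms(1)]])

lemma abs_support_fun_le:
  assumes bd: "\<And>z. z \<in> C \<Longrightarrow> norm z \<le> R" and "C \<noteq> {}"
  shows "\<bar>support_fun C y\<bar> \<le> R * norm y"
proof -
  have *: "\<bar>z \<bullet> y\<bar> \<le> R * norm y" if "z \<in> C" for z
  proof -
    have "\<bar>z \<bullet> y\<bar> \<le> norm z * norm y" by (rule Cauchy_Schwarz_ineq2)
    also have "\<dots> \<le> R * norm y" by (intro mult_right_mono bd that) simp
    finally show ?thesis .
  qed
  obtain z where "z \<in> C" using assms(2) by blast
  have "support_fun C y \<le> R * norm y"
    unfolding support_fun_def by (rule cSUP_least[OF assms(2)]) (use * in force)
  moreover have "- (R * norm y) \<le> support_fun C y"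
    using inner_le_support_fun[OF bd \<open>z \<in> C\<close>, of y] *[OF \<open>z \<in> C\<close>] by linarith
  ultimately show ?thesis by linarith
qed

text \<open>A supremum of continuous functions is lower semicontinuous; this gives measurability although
  the supremum ranges over an uncountable set.\<close>

lemma borel_measurable_support_fun:
  assumes "\<And>z. z \<in> C \<Longrightarrow> norm z \<le> R" and "C \<noteq> {}"
  shows "support_fun C \<in> borel_measurable borel"
proof (rule borel_measurableI_greater)
  fix c :: real
  have "{y \<in> space borel. c < support_fun C y} = (\<Union>z\<in>C. {y. c < z \<bullet> y})"
    unfolding support_fun_def
    using less_cSUP_iff[OF assms(2) bdd_above_inner_image[OF assms(1)]] by auto
  moreover have "open (\<Union>z\<in>C. {y. c < z \<bullet> y})"
    by (intro open_UN ballI open_Collect_less continuous_intros)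
  ultimately show "{y \<in> space borel. c < support_fun C y} \<in> sets borel" by simp
qed

lemma borel_measurable_INF_dist_sq:
  fixes C :: "'m::real_inner set"
  assumes "C \<noteq> {}"
  shows "(\<lambda>y. INF z\<in>C. (norm (z - y))\<^sup>2) \<in> borel_measurable borel"
proof (rule borel_measurableI_less)
  fix c :: real
  have "bdd_below ((\<lambda>z. (norm (z - y))\<^sup>2) ` C)" for y
    by (rule bdd_belowI2[of _ 0]) simp
  then have "{y \<in> space borel. (INF z\<in>C. (norm (z - y))\<^sup>2) < c}
      = (\<Union>z\<in>C. {y. (norm (z - y))\<^sup>2 < c})"
    using cINF_less_iff[OF assms] by auto
  moreover have "open (\<Union>z\<in>C. {y. (norm (z - y))\<^sup>2 < c})"
    by (intro open_UN ballI open_Collect_less continuous_intros)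
  ultimately show "{y \<in> space borel. (INF z\<in>C. (norm (z - y))\<^sup>2) < c} \<in> sets borel" by simp
qed

text \<open>For the two estimates below, expand
  \<open>(norm (l *\<^sub>R z - y))\<^sup>2 = l\<^sup>2 * (norm z)\<^sup>2 + (norm y)\<^sup>2 - 2 * l * (z \<bullet> y)\<close>
  and bound the first term uniformly over \<open>z\<close>; what is left to optimize is the inner product.\<close>

lemma INF_dist_sq_scaled_le:
  fixes C :: "'m::real_inner set"
  assumes bd: "\<And>z. z \<in> C \<Longrightarrow> norm z \<le> R" and "C \<noteq> {}" and "l \<ge> 0"
  shows "(INF z\<in>C. (norm (l *\<^sub>R z - y))\<^sup>2) \<le> (norm y)\<^sup>2 + l\<^sup>2 * R\<^sup>2 - 2 * l * support_fun C y"
    (is "?I \<le> _")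
proof (cases "l = 0")
  case True
  then show ?thesis using assms(2) by simp
next
  case False
  then have "l > 0" using assms(3) by simp
  have "z \<bullet> y \<le> ((norm y)\<^sup>2 + l\<^sup>2 * R\<^sup>2 - ?I) / (2 * l)" if "z \<in> C" for z
  proof -
    have "?I \<le> (norm (l *\<^sub>R z - y))\<^sup>2"
      by (rule cINF_lower[OF _ that]) (rule bdd_belowI2[of _ 0], simp)
    also have "\<dots> = l\<^sup>2 * (norm z)\<^sup>2 + (norm y)\<^sup>2 - 2 * l * (z \<bullet> y)"
      unfolding power2_norm_eq_inner
      by (simp add: inner_diff_left inner_diff_right inner_commute power2_eq_square algebra_simps)
    also have "\<dots> \<le> l\<^sup>2 * R\<^sup>2 + (norm y)\<^sup>2 - 2 * l * (z \<bullet> y)"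
      using bd[OF that] by (intro diff_right_mono add_right_mono mult_left_mono power_mono) auto
    finally show ?thesis using \<open>l > 0\<close> by (simp add: field_simps)
  qed
  then have "support_fun C y \<le> ((norm y)\<^sup>2 + l\<^sup>2 * R\<^sup>2 - ?I) / (2 * l)"
    unfolding support_fun_def by (intro cSUP_least assms(2))
  then show ?thesis using \<open>l > 0\<close> by (simp add: field_simps)
qed

lemma INF_dist_sq_ge:
  fixes C :: "'m::real_inner set"
  assumes bd: "\<And>z. z \<in> C \<Longrightarrow> r \<le> norm z \<and> norm z \<le> R" and "C \<noteq> {}" and "r \<ge> 0"
  shows "(norm y)\<^sup>2 + r\<^sup>2 - 2 * support_fun C y \<le> (INF z\<in>C. (norm (z - y))\<^sup>2)"
proof (rule cINF_greatest[OF assms(2)])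
  fix z assume z: "z \<in> C"
  have "z \<bullet> y \<le> support_fun C y" using bd by (intro inner_le_support_fun z) blast
  moreover have "r\<^sup>2 \<le> (norm z)\<^sup>2" using bd[OF z] assms(3) by (intro power_mono) auto
  moreover have "(norm (z - y))\<^sup>2 = (norm z)\<^sup>2 + (norm y)\<^sup>2 - 2 * (z \<bullet> y)"
    by (simp add: power2_norm_eq_inner inner_diff_left inner_diff_right inner_commute)
  ultimately show "(norm y)\<^sup>2 + r\<^sup>2 - 2 * support_fun C y \<le> (norm (z - y))\<^sup>2" by linarith
qed

text \<open>Every \<open>z\<close> in the set satisfies \<open>z \<bullet> u \<ge> - R\<^sup>2\<close> by Cauchy-Schwarz, so translating by \<open>u\<close> costs
  at most \<open>R\<^sup>2\<close>.\<close>

lemma support_fun_shift_ge: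
  fixes C :: "'m::real_inner set"
  assumes bd: "\<And>z. z \<in> C \<Longrightarrow> norm z \<le> R" and "u \<in> C" and "s > 0"
  shows "s * support_fun C e - R\<^sup>2 \<le> support_fun C (u + s *\<^sub>R e)"
proof -
  have "z \<bullet> e \<le> (support_fun C (u + s *\<^sub>R e) + R\<^sup>2) / s" if "z \<in> C" for z
  proof -
    have "z \<bullet> (u + s *\<^sub>R e) \<le> support_fun C (u + s *\<^sub>R e)" by (rule inner_le_support_fun[OF bd that])
    moreover have "- (z \<bullet> u) \<le> norm z * norm u"
      using Cauchy_Schwarz_ineq2[of z u] by linarith
    moreover have "norm z * norm u \<le> R * R"
      using bd[OF that] bd[OF assms(2)] by (intro mult_mono) (auto intro: order_trans[OF norm_ge_zero])
    ultimately show ?thesis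
      using assms(3) by (simp add: inner_add_right field_simps power2_eq_square)
  qed
  then have "support_fun C e \<le> (support_fun C (u + s *\<^sub>R e) + R\<^sup>2) / s"
    unfolding support_fun_def[of C e] using assms(2) by (intro cSUP_least) auto
  then show ?thesis using assms(3) by (simp add: field_simps)
qed

text \<open>If the estimate \<open>support_fun_shift_ge\<close> is sharp, then any \<open>z\<close> that nearly maximizes \<open>z \<bullet> e\<close> has
  \<open>z \<bullet> u\<close> close to \<open>- R\<^sup>2\<close>. As \<open>z\<close> and \<open>u\<close> both have norm at most \<open>R\<close>, this forces \<open>z\<close> to be close to
  \<open>- u\<close>, and hence \<open>z \<bullet> e\<close> to be close to \<open>- (u \<bullet> e)\<close>.\<close>

lemma support_fun_shift_equality_case:
  fixes C :: "'m::real_inner set"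
  assumes bd: "\<And>z. z \<in> C \<Longrightarrow> norm z \<le> R" and u: "u \<in> C" and s: "s > 0"
    and eq: "support_fun C (u + s *\<^sub>R e) \<le> s * support_fun C e - R\<^sup>2"
  shows "support_fun C e \<le> - (u \<bullet> e)"
proof -
  \<comment> \<open>The slack in the near-maximum is \<open>d\<^sup>2\<close>, so that the distance from \<open>z\<close> to \<open>- u\<close> is of order \<open>d\<close>.\<close>
  have approx: "support_fun C e + u \<bullet> e \<le> d * sqrt (2 * s) * norm e + d\<^sup>2" if d: "d > 0" for d
  proof -
    have "support_fun C e - d\<^sup>2 < support_fun C e" using d by simp
    then obtain z where z: "z \<in> C" and ze: "support_fun C e - d\<^sup>2 < z \<bullet> e"
      unfolding support_fun_def
      using less_cSUP_iff[OF _ bdd_above_inner_image[OF bd]] u by blast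
    have "z \<bullet> (u + s *\<^sub>R e) \<le> support_fun C (u + s *\<^sub>R e)" by (rule inner_le_support_fun[OF bd z])
    with eq have "z \<bullet> u + s * (z \<bullet> e) \<le> s * support_fun C e - R\<^sup>2" by (simp add: inner_add_right)
    moreover have "s * (support_fun C e - d\<^sup>2) \<le> s * (z \<bullet> e)" using ze s by (intro mult_left_mono) auto
    ultimately have "z \<bullet> u \<le> s * d\<^sup>2 - R\<^sup>2" by (simp add: algebra_simps)
    moreover have "(norm z)\<^sup>2 \<le> R\<^sup>2" "(norm u)\<^sup>2 \<le> R\<^sup>2"
      using bd[OF z] bd[OF u] by (auto intro: power_mono)
    moreover have "(norm (z + u))\<^sup>2 = (norm z)\<^sup>2 + (norm u)\<^sup>2 + 2 * (z \<bullet> u)"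
      by (simp add: power2_norm_eq_inner inner_add_left inner_add_right inner_commute)
    ultimately have "(norm (z + u))\<^sup>2 \<le> d\<^sup>2 * (2 * s)" by (simp add: algebra_simps)
    then have "norm (z + u) \<le> sqrt (d\<^sup>2 * (2 * s))" by (rule real_le_rsqrt)
    also have "\<dots> = d * sqrt (2 * s)" using d by (simp only: real_sqrt_mult) simp
    finally have "norm (z + u) * norm e \<le> d * sqrt (2 * s) * norm e" by (rule mult_right_mono) simp
    moreover have "(z + u) \<bullet> e \<le> norm (z + u) * norm e" by (rule norm_cauchy_schwarz)
    ultimately show ?thesis using ze by (simp add: inner_add_left)
  qed
  have "((\<lambda>d. d * sqrt (2 * s) * norm e + d\<^sup>2) \<longlongrightarrow> 0 * sqrt (2 * s) * norm e + 0\<^sup>2) (at_right 0)"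
    by (intro tendsto_intros)
  then have "support_fun C e + u \<bullet> e \<le> 0 * sqrt (2 * s) * norm e + 0\<^sup>2"
    by (rule tendsto_lowerbound) (auto simp: eventually_at_right_less intro!: eventually_mono[OF eventually_at_right_less] approx)
  then show ?thesis by simp
qed

section \<open>Independence and Bochner means\<close>

lemma has_bochner_mean_inner:
  assumes "has_bochner_mean P X \<mu>"
  shows "has_bochner_integral P (\<lambda>\<omega>. z \<bullet> X \<omega>) (z \<bullet> \<mu>)"
proof -
  from assms obtain s where X: "X \<in> borel_measurable P"
    and s: "\<And>i. Bochner_Integration.simple_bochner_integrable P (s i)"
    and L1: "(\<lambda>i::nat. \<integral>\<^sup>+\<omega>. ennreal (norm (X \<omega> - s i \<omega>)) \<partial>P) \<longlonglongrightarrow> 0"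
    and lim: "(\<lambda>i. Bochner_Integration.simple_bochner_integral P (s i)) \<longlonglongrightarrow> \<mu>"
    unfolding has_bochner_mean_def by blast
  have lin: "linear (\<lambda>x. z \<bullet> x)"
    by (simp add: bounded_linear.linear bounded_linear_inner_right)
  show ?thesis
  proof (rule has_bochner_integral.intros)
    show "(\<lambda>\<omega>. z \<bullet> X \<omega>) \<in> borel_measurable P"
      by (rule measurable_compose[OF X])
        (intro borel_measurable_continuous_onI continuous_intros)
    show "Bochner_Integration.simple_bochner_integrable P (\<lambda>\<omega>. z \<bullet> s i \<omega>)" for i
      using simple_bochner_integrable_compose2[of "\<lambda>x y. z \<bullet> x", OF _ s s] by simp
    show "(\<lambda>i. Bochner_Integration.simple_bochner_integral P (\<lambda>\<omega>. z \<bullet> s i \<omega>)) \<longlonglongrightarrow> z \<bullet> \<mu>"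
      unfolding simple_bochner_integral_linear[OF lin s] by (intro tendsto_intros lim)
    \<comment> \<open>A difference of Borel maps need not be Borel in a nonseparable space; here one of the two
      takes only finitely many values.\<close>
    have meas: "(\<lambda>\<omega>. norm (X \<omega> - s i \<omega>)) \<in> borel_measurable P" for i
    proof (rule measurable_compose_countable'[where g = "s i" and I = "s i ` space P"])
      have "simple_function P (s i)"
        using s[of i] by (auto elim: Bochner_Integration.simple_bochner_integrable.cases)
      then show "s i \<in> measurable P (count_space (s i ` space P))"
        and "countable (s i ` space P)"
        by (auto simp: simple_function_def measurable_count_space_eq2 countable_finite)
      show "(\<lambda>\<omega>. norm (X \<omega> - v)) \<in> borel_measurable P" for v
        by (rule measurable_compose[OF X])
          (intro borel_measurable_continuous_onI continuous_intros)
    qed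
    have "(\<lambda>i. ennreal (norm z) * (\<integral>\<^sup>+\<omega>. ennreal (norm (X \<omega> - s i \<omega>)) \<partial>P))
        \<longlonglongrightarrow> ennreal (norm z) * 0"
      by (intro ennreal_tendsto_cmult L1) simp
    then have lim0: "(\<lambda>i. \<integral>\<^sup>+\<omega>. ennreal (norm z) * ennreal (norm (X \<omega> - s i \<omega>)) \<partial>P) \<longlonglongrightarrow> 0"
      using meas by (simp add: nn_integral_cmult)
    have "ennreal (norm (z \<bullet> X \<omega> - z \<bullet> s i \<omega>)) \<le> ennreal (norm z) * ennreal (norm (X \<omega> - s i \<omega>))"
      for i \<omega>
      using Cauchy_Schwarz_ineq2[of z "X \<omega> - s i \<omega>"]
      by (simp add: inner_diff_right ennreal_leI flip: ennreal_mult')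
    then show "(\<lambda>i. \<integral>\<^sup>+\<omega>. ennreal (norm (z \<bullet> X \<omega> - z \<bullet> s i \<omega>)) \<partial>P) \<longlonglongrightarrow> 0"
      by (intro tendsto_sandwich[OF _ _ tendsto_const lim0])
        (auto intro!: always_eventually nn_integral_mono)
  qed
qed

text \<open>The approximating simple functions together take countably many values. The distance from
  \<open>X\<close> to the set of these values is at most the distance from \<open>X\<close> to each approximation, so its
  integral is zero.\<close>

lemma has_bochner_mean_separably_valued:
  assumes "has_bochner_mean P X \<mu>"
  obtains d :: "nat \<Rightarrow> 'm::real_inner" where "AE \<omega> in P. X \<omega> \<in> closure (range d)"
proof -
  from assms obtain s where X: "X \<in> borel_measurable P"
    and s: "\<And>i. Bochner_Integration.simple_bochner_integrable P (s i)"
    and L1: "(\<lambda>i::nat. \<integral>\<^sup>+\<omega>. ennreal (norm (X \<omega> - s i \<omega>)) \<partial>P) \<longlonglongrightarrow> 0"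
    unfolding has_bochner_mean_def by blast
  define D where "D = insert 0 (\<Union>i. s i ` space P)"
  have "finite (s i ` space P)" for i
    using s[of i] by (auto elim!: Bochner_Integration.simple_bochner_integrable.cases simp: simple_function_def)
  then have "countable D" unfolding D_def by (auto intro: countable_finite)
  then obtain d :: "nat \<Rightarrow> 'm" where d: "range d = D"
    using uncountable_def[of D] by (auto simp: D_def)
  have meas: "(\<lambda>\<omega>. infdist (X \<omega>) D) \<in> borel_measurable P"
    by (rule measurable_compose[OF X])
      (intro borel_measurable_continuous_onI continuous_intros)
  have "(\<integral>\<^sup>+\<omega>. ennreal (infdist (X \<omega>) D) \<partial>P) \<le> (\<integral>\<^sup>+\<omega>. ennreal (norm (X \<omega> - s i \<omega>)) \<partial>P)" for i
    by (intro nn_integral_mono ennreal_leI)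
      (auto simp: D_def dist_norm[symmetric] intro!: infdist_le)
  then have "(\<integral>\<^sup>+\<omega>. ennreal (infdist (X \<omega>) D) \<partial>P) \<le> 0"
    by (intro tendsto_lowerbound[OF L1]) auto
  then have "AE \<omega> in P. ennreal (infdist (X \<omega>) D) = 0"
    using meas by (subst (asm) le_zero_eq, subst (asm) nn_integral_0_iff_AE) auto
  then have "AE \<omega> in P. X \<omega> \<in> closure (range d)"
    by eventually_elim
      (auto simp: d in_closure_iff_infdist_zero D_def infdist_nonneg order_antisym)
  then show ?thesis by (rule that)
qed

text \<open>Restricted to a separable set, the inner product is the limit of the functions obtained by
  rounding the second argument to a point of a countable dense set. These are measurable for the
  product \<sigma>-algebra because the rounded argument takes countably many values.\<close>

lemma measurable_inner_on_separable_part: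
  fixes f :: "'g \<Rightarrow> 'm::real_inner" and d :: "nat \<Rightarrow> 'm"
  assumes f: "f \<in> borel_measurable S"
  obtains h :: "'g \<times> 'm \<Rightarrow> real" where "h \<in> borel_measurable (S \<Otimes>\<^sub>M borel)"
    and "\<And>g e. e \<in> closure (range d) \<Longrightarrow> h (g, e) = f g \<bullet> e"
proof -
  \<comment> \<open>\<open>d (k n e)\<close> is the rounding of \<open>e\<close> with precision \<open>1 / (n + 1)\<close>, for \<open>e\<close> in the closure.\<close>
  define k where "k n e = (LEAST i. dist (d i) e < inverse (real (Suc n)))" for n e
  define h where "h p = lim (\<lambda>n. f (fst p) \<bullet> d (k n (snd p)))" for p
  have k: "k n \<in> measurable borel (count_space UNIV)" for n
  proof -
    have "(\<lambda>e. dist (d i) e) \<in> borel_measurable borel" for i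
      by (intro borel_measurable_continuous_onI continuous_intros)
    then show ?thesis unfolding k_def by measurable
  qed
  have inner: "(\<lambda>p. f (fst p) \<bullet> d i) \<in> borel_measurable (S \<Otimes>\<^sub>M borel)" for i
  proof -
    have "(\<lambda>x. x \<bullet> d i) \<in> borel_measurable borel"
      by (intro borel_measurable_continuous_onI continuous_intros)
    then show ?thesis using f by measurable
  qed
  have "(\<lambda>p. f (fst p) \<bullet> d (k n (snd p))) \<in> borel_measurable (S \<Otimes>\<^sub>M borel)" for n
    by (rule measurable_compose_countable[OF inner]) (use k in measurable)
  then have "h \<in> borel_measurable (S \<Otimes>\<^sub>M borel)"
    unfolding h_def by (rule borel_measurable_lim_metric)
  moreover have "h (g, e) = f g \<bullet> e" if e: "e \<in> closure (range d)" for g e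
  proof -
    have close: "dist (d (k n e)) e < inverse (real (Suc n))" for n
    proof -
      have "\<exists>i. dist (d i) e < inverse (real (Suc n))"
        using e unfolding closure_approachable by (auto dest!: spec[of _ "inverse (real (Suc n))"])
      then show ?thesis unfolding k_def by (rule LeastI_ex)
    qed
    have "(\<lambda>n. d (k n e)) \<longlonglongrightarrow> e"
      unfolding tendsto_dist_iff[of _ e]
      by (rule tendsto_sandwich[OF _ _ tendsto_const LIMSEQ_inverse_real_of_nat])
        (use close in \<open>auto intro!: always_eventually less_imp_le simp del: of_nat_Suc\<close>)
    then have "(\<lambda>n. f g \<bullet> d (k n e)) \<longlonglongrightarrow> f g \<bullet> e" by (intro tendsto_intros)
    then show ?thesis unfolding h_def by (simp add: limI)
  qed
  ultimately show ?thesis by (rule that)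
qed

lemma indep_rvs_distr_pair:
  assumes "prob_space P" and "indep_rvs P S X T Z"
  shows "distr P S X \<Otimes>\<^sub>M distr P T Z = distr P (S \<Otimes>\<^sub>M T) (\<lambda>\<omega>. (X \<omega>, Z \<omega>))"
proof -
  interpret P: prob_space P by fact
  have X[measurable]: "X \<in> measurable P S" and Z[measurable]: "Z \<in> measurable P T"
    and ind: "P.indep_set {X -` A \<inter> space P |A. A \<in> sets S} {Z -` B \<inter> space P |B. B \<in> sets T}"
    using assms(2) by (auto simp: indep_rvs_def)
  interpret DX: prob_space "distr P S X" by (rule P.prob_space_distr[OF X])
  interpret DZ: prob_space "distr P T Z" by (rule P.prob_space_distr[OF Z])
  show ?thesis
  proof (rule pair_measure_eqI)
    fix A B assume "A \<in> sets (distr P S X)" "B \<in> sets (distr P T Z)"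
    then have [measurable]: "A \<in> sets S" "B \<in> sets T" by auto
    have "P.prob ((X -` A \<inter> space P) \<inter> (Z -` B \<inter> space P))
        = P.prob (X -` A \<inter> space P) * P.prob (Z -` B \<inter> space P)"
      by (rule P.indep_setD[OF ind]) auto
    moreover have "(\<lambda>\<omega>. (X \<omega>, Z \<omega>)) -` (A \<times> B) \<inter> space P
        = (X -` A \<inter> space P) \<inter> (Z -` B \<inter> space P)" by auto
    ultimately show "emeasure (distr P S X) A * emeasure (distr P T Z) B
        = emeasure (distr P (S \<Otimes>\<^sub>M T) (\<lambda>\<omega>. (X \<omega>, Z \<omega>))) (A \<times> B)"
      by (simp add: emeasure_distr P.emeasure_eq_measure ennreal_mult)
  qed (auto simp: DX.sigma_finite_measure_axioms DZ.sigma_finite_measure_axioms cong: sets_pair_measure_cong)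
qed

text \<open>The joint law is the product of the two laws, so this is Fubini's theorem, applied to a
  function \<open>h\<close> that is measurable for the product \<sigma>-algebra and agrees with the inner product at
  almost all values of \<open>Z\<close>. Integrability is a hypothesis because in a nonseparable space even the
  measurability of \<open>f (X \<omega>) \<bullet> Z \<omega>\<close> in \<open>\<omega>\<close> is not automatic.\<close>

lemma expectation_inner_indep:
  fixes f :: "'g \<Rightarrow> 'm::real_inner"
  assumes "prob_space P" and ind: "indep_rvs P S X borel Z"
    and f: "f \<in> borel_measurable S"
    and mean: "has_bochner_mean P Z \<mu>"
    and int: "integrable P (\<lambda>\<omega>. f (X \<omega>) \<bullet> Z \<omega>)"
  shows "(\<integral>\<omega>. f (X \<omega>) \<bullet> Z \<omega> \<partial>P) = (\<integral>\<omega>. f (X \<omega>) \<bullet> \<mu> \<partial>P)"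
proof -
  interpret P: prob_space P by fact
  have X[measurable]: "X \<in> measurable P S" and Z[measurable]: "Z \<in> borel_measurable P"
    using ind by (auto simp: indep_rvs_def)
  let ?X = "distr P S X" and ?Z = "distr P borel Z"
  interpret DX: prob_space ?X by (rule P.prob_space_distr[OF X])
  interpret DZ: prob_space ?Z by (rule P.prob_space_distr[OF Z])
  interpret XZ: pair_sigma_finite ?X ?Z ..
  obtain d :: "nat \<Rightarrow> 'm" where d: "AE \<omega> in P. Z \<omega> \<in> closure (range d)"
    using has_bochner_mean_separably_valued[OF mean] .
  obtain h :: "'g \<times> 'm \<Rightarrow> real" where h[measurable]: "h \<in> borel_measurable (S \<Otimes>\<^sub>M borel)"
    and hd: "\<And>g e. e \<in> closure (range d) \<Longrightarrow> h (g, e) = f g \<bullet> e"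
    using measurable_inner_on_separable_part[OF f, of d] by blast
  have h_joint: "AE \<omega> in P. h (X \<omega>, Z \<omega>) = f (X \<omega>) \<bullet> Z \<omega>"
    using d by eventually_elim (rule hd)
  have h_slice: "(\<integral>e. h (g, e) \<partial>?Z) = f g \<bullet> \<mu>" if "g \<in> space S" for g
  proof -
    have [measurable]: "(\<lambda>e. h (g, e)) \<in> borel_measurable borel" using that by measurable
    note inner_mean = has_bochner_mean_inner[OF mean, of "f g"]
    have "(\<integral>e. h (g, e) \<partial>?Z) = (\<integral>\<omega>. h (g, Z \<omega>) \<partial>P)" by (simp add: integral_distr)
    also have "\<dots> = (\<integral>\<omega>. f g \<bullet> Z \<omega> \<partial>P)"
    proof (rule integral_cong_AE)
      show "(\<lambda>\<omega>. f g \<bullet> Z \<omega>) \<in> borel_measurable P"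
        using inner_mean by (rule borel_measurable_has_bochner_integral)
      show "AE \<omega> in P. h (g, Z \<omega>) = f g \<bullet> Z \<omega>" using d by eventually_elim (rule hd)
    qed measurable
    also have "\<dots> = f g \<bullet> \<mu>" using inner_mean by (rule has_bochner_integral_integral_eq)
    finally show ?thesis .
  qed
  have "integrable P (\<lambda>\<omega>. h (X \<omega>, Z \<omega>))"
    using int by (rule integrable_cong_AE_imp) (use h_joint in auto)
  then have int_h: "integrable (?X \<Otimes>\<^sub>M ?Z) h"
    by (simp add: indep_rvs_distr_pair[OF assms(1) ind] integrable_distr_eq)
  have "(\<integral>\<omega>. f (X \<omega>) \<bullet> Z \<omega> \<partial>P) = (\<integral>\<omega>. h (X \<omega>, Z \<omega>) \<partial>P)"
    by (rule integral_cong_AE) (use h_joint int in auto)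
  also have "\<dots> = integral\<^sup>L (?X \<Otimes>\<^sub>M ?Z) h"
    by (simp add: indep_rvs_distr_pair[OF assms(1) ind] integral_distr)
  also have "\<dots> = (\<integral>g. (\<integral>e. h (g, e) \<partial>?Z) \<partial>?X)"
    by (rule XZ.integral_fst'[OF int_h, symmetric])
  also have "\<dots> = (\<integral>g. f g \<bullet> \<mu> \<partial>?X)"
    by (intro Bochner_Integration.integral_cong) (auto simp: h_slice)
  also have "\<dots> = (\<integral>\<omega>. f (X \<omega>) \<bullet> \<mu> \<partial>P)"
  proof (rule integral_distr[OF X])
    have "(\<lambda>x. x \<bullet> \<mu>) \<in> borel_measurable borel"
      by (intro borel_measurable_continuous_onI continuous_intros)
    then show "(\<lambda>g. f g \<bullet> \<mu>) \<in> borel_measurable S" using f by measurable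
  qed
  finally show ?thesis .
qed

section \<open>Inconsistency at and above the critical noise level\<close>

lemma beyond_larger_root:
  fixes q r b :: real
  assumes "q > 0" and "1 - b * q \<ge> 0" and r: "r = (1 + sqrt (1 - b * q)) / q" and "s > r"
  shows "q * s\<^sup>2 - 2 * s + b > 0" and "s > 0"
proof -
  have "q * r = 1 + sqrt (1 - b * q)" using assms(1) r by simp
  moreover have "q * r < q * s" using assms(1,4) by simp
  ultimately have "q * s > 1 + sqrt (1 - b * q)" by simp
  then have "q * s - 1 > sqrt (1 - b * q)" by simp
  then have "(q * s - 1)\<^sup>2 > (sqrt (1 - b * q))\<^sup>2" by (rule power_strict_mono) (use assms in auto)
  then have "q * (q * s\<^sup>2 - 2 * s + b) > 0" using assms(2)
    by (simp add: power2_eq_square algebra_simps)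
  then show "q * s\<^sup>2 - 2 * s + b > 0" using assms(1) by (simp add: zero_less_mult_iff)
  have "r > 0" unfolding r using assms(1,2) by (intro divide_pos_pos add_pos_nonneg) auto
  then show "s > 0" using assms by simp
qed

theorem proposition3p7:
  fixes G :: "('g, 'b) monoid_scheme"
    and act :: "'g \<Rightarrow> 'm::{real_inner, complete_space} \<Rightarrow> 'm"
    and S :: "'g measure"
    and P :: "'w measure"
    and \<Phi> :: "'w \<Rightarrow> 'g"
    and \<epsilon> Y :: "'w \<Rightarrow> 'm"
    and t0 :: 'm
    and a A \<sigma> :: real
  assumes "linear_group_action G act"
    and "t0 \<noteq> 0"
    and "a \<ge> 0" and "A > 0"
    and "\<And>g. g \<in> carrier G \<Longrightarrow> a * norm t0 \<le> norm (act g t0) \<and> norm (act g t0) \<le> A * norm t0"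
    and "A < sqrt 2"
    and "prob_space P"
    and "space S = carrier G"
    and "(\<lambda>g. act g t0) \<in> borel_measurable S"
    and "standardized_noise P \<epsilon>"
    and "indep_rvs P S \<Phi> borel \<epsilon>"
    and "\<sigma> > 0"
    and "Y = (\<lambda>\<omega>. act (\<Phi> \<omega>) t0 + \<sigma> *\<^sub>R \<epsilon> \<omega>)"
    and "Y \<in> borel_measurable P"
    and "integrable P (\<lambda>\<omega>. (norm (Y \<omega>))\<^sup>2)"
    and "theta P G act \<epsilon> t0 > 0"
    and "\<sigma> \<ge> norm t0 / theta P G act \<epsilon> t0 *
               (A\<^sup>2 + (1 + sqrt (1 - a\<^sup>2 * (2 - A\<^sup>2))) / (2 - A\<^sup>2))"
  shows "\<not> consistent P G act Y t0"
proof
  assume cons: "consistent P G act Y t0"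
  interpret P: prob_space P by fact
  note [measurable] = \<open>Y \<in> borel_measurable P\<close>
  have ga: "group_action G UNIV act" and lin: "\<And>g. g \<in> carrier G \<Longrightarrow> linear (act g)"
    using assms(1) by (auto simp: linear_group_action_def)
  interpret group_action G UNIV act by (rule ga)
  define C where "C = (\<lambda>g. act g t0) ` carrier G"
  define R where "R = A * norm t0"
  define x where "x = (norm t0)\<^sup>2"
  define h where "h = support_fun C"
  define Z where "Z \<omega> = act (\<Phi> \<omega>) t0" for \<omega>
  have "x > 0" using assms(2) by (simp add: x_def)
  have "carrier G \<noteq> {}" using group_hom by (auto simp: group_hom_def dest: group.is_monoid monoid.one_closed)
  then have C_ne: "C \<noteq> {}" by (simp add: C_def)
  have C_bd: "norm z \<le> R" and C_bd': "a * norm t0 \<le> norm z \<and> norm z \<le> R" if "z \<in> C" for z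
    using that assms(5) by (auto simp: C_def R_def)
  have "R\<^sup>2 = A\<^sup>2 * x" by (simp add: R_def x_def power_mult_distrib)

  have \<Phi>[measurable]: "\<Phi> \<in> measurable P S" and \<epsilon>[measurable]: "\<epsilon> \<in> borel_measurable P"
    using assms(11) by (auto simp: indep_rvs_def)
  have Z[measurable]: "Z \<in> borel_measurable P"
    unfolding Z_def using measurable_compose[OF \<Phi> assms(9)] .
  have ZC: "Z \<omega> \<in> C" if "\<omega> \<in> space P" for \<omega>
    using measurable_space[OF \<Phi> that] assms(8) by (auto simp: Z_def C_def)
  have Y: "Y \<omega> = Z \<omega> + \<sigma> *\<^sub>R \<epsilon> \<omega>" for \<omega> by (simp add: assms(13) Z_def)
  have h_meas[measurable]: "h \<in> borel_measurable borel"
    unfolding h_def by (rule borel_measurable_support_fun[OF C_bd C_ne])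
  have h_bound: "\<bar>h y\<bar> \<le> R * norm y" for y unfolding h_def by (rule abs_support_fun_le[OF C_bd C_ne])

  have int_norm: "integrable P (\<lambda>\<omega>. norm (V \<omega>))"
    if [measurable]: "V \<in> borel_measurable P" and "integrable P (\<lambda>\<omega>. (norm (V \<omega>))\<^sup>2)" for V :: "'w \<Rightarrow> 'm"
    using that(2) by (rule P.square_integrable_imp_integrable[rotated]) measurable
  have "integrable P (\<lambda>\<omega>. (norm (\<epsilon> \<omega>))\<^sup>2)"
    using assms(10) not_integrable_integral_eq by (fastforce simp: standardized_noise_def)
  then have int_\<epsilon>: "integrable P (\<lambda>\<omega>. norm (\<epsilon> \<omega>))" by (intro int_norm) measurable
  have int_h: "integrable P (\<lambda>\<omega>. h (V \<omega>))"
    if [measurable]: "V \<in> borel_measurable P" and "integrable P (\<lambda>\<omega>. norm (V \<omega>))" for V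
  proof (rule Bochner_Integration.integrable_bound)
    show "integrable P (\<lambda>\<omega>. R * norm (V \<omega>))" using that(2) by simp
    show "AE \<omega> in P. norm (h (V \<omega>)) \<le> norm (R * norm (V \<omega>))"
      using h_bound by (auto intro: order_trans[OF _ abs_ge_self])
  qed measurable
  have int_hY: "integrable P (\<lambda>\<omega>. h (Y \<omega>))" and int_h\<epsilon>: "integrable P (\<lambda>\<omega>. h (\<epsilon> \<omega>))"
    using int_h int_norm int_\<epsilon> assms(15) by auto

  \<comment> \<open>The polarization identity makes the inner product of \<open>Z\<close> and \<open>\<epsilon>\<close> measurable, thanks to the
    measurability of \<open>Y\<close>.\<close>
  have inner_eq: "Z \<omega> \<bullet> \<epsilon> \<omega> = ((norm (Y \<omega>))\<^sup>2 - (norm (Z \<omega>))\<^sup>2 - \<sigma>\<^sup>2 * (norm (\<epsilon> \<omega>))\<^sup>2) / (2 * \<sigma>)" for \<omega>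
    using \<open>\<sigma> > 0\<close> unfolding Y power2_norm_eq_inner
    by (simp add: inner_add_left inner_add_right inner_commute power2_eq_square field_simps)
  have int_Z\<epsilon>: "integrable P (\<lambda>\<omega>. Z \<omega> \<bullet> \<epsilon> \<omega>)"
  proof (rule Bochner_Integration.integrable_bound)
    show "integrable P (\<lambda>\<omega>. R * norm (\<epsilon> \<omega>))" using int_\<epsilon> by simp
    show "(\<lambda>\<omega>. Z \<omega> \<bullet> \<epsilon> \<omega>) \<in> borel_measurable P" unfolding inner_eq by measurable
    show "AE \<omega> in P. norm (Z \<omega> \<bullet> \<epsilon> \<omega>) \<le> norm (R * norm (\<epsilon> \<omega>))"
    proof (rule AE_I2)
      fix \<omega> assume "\<omega> \<in> space P"
      have "\<bar>Z \<omega> \<bullet> \<epsilon> \<omega>\<bar> \<le> norm (Z \<omega>) * norm (\<epsilon> \<omega>)" by (rule Cauchy_Schwarz_ineq2)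
      also have "\<dots> \<le> R * norm (\<epsilon> \<omega>)"
        by (intro mult_right_mono C_bd ZC \<open>\<omega> \<in> space P\<close>) simp
      finally show "norm (Z \<omega> \<bullet> \<epsilon> \<omega>) \<le> norm (R * norm (\<epsilon> \<omega>))" by simp
    qed
  qed
  have EZ\<epsilon>: "(\<integral>\<omega>. Z \<omega> \<bullet> \<epsilon> \<omega> \<partial>P) = 0"
    using expectation_inner_indep[OF assms(7,11,9), of 0] assms(10) int_Z\<epsilon>
    by (simp add: standardized_noise_def Z_def)

  have theta: "(\<integral>\<omega>. h (\<epsilon> \<omega>) \<partial>P) = theta P G act \<epsilon> t0 * norm t0"
    using assms(2) by (simp add: theta_def h_def support_fun_def C_def image_image)
  then have E_pos: "(\<integral>\<omega>. h (\<epsilon> \<omega>) \<partial>P) > 0" using assms(2,16) by simp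

  have shift: "\<sigma> * h (\<epsilon> \<omega>) - R\<^sup>2 \<le> h (Y \<omega>)" if "\<omega> \<in> space P" for \<omega>
    unfolding h_def Y by (rule support_fun_shift_ge[OF C_bd ZC[OF that] \<open>\<sigma> > 0\<close>])
  have E_ge: "\<sigma> * (\<integral>\<omega>. h (\<epsilon> \<omega>) \<partial>P) - R\<^sup>2 \<le> (\<integral>\<omega>. h (Y \<omega>) \<partial>P)"
  proof -
    have "(\<integral>\<omega>. \<sigma> * h (\<epsilon> \<omega>) - R\<^sup>2 \<partial>P) \<le> (\<integral>\<omega>. h (Y \<omega>) \<partial>P)"
      using int_hY int_h\<epsilon> shift by (intro integral_mono) auto
    then show ?thesis using int_h\<epsilon> by (simp add: P.prob_space)
  qed
  \<comment> \<open>Strictness, by independence of \<open>\<Phi>\<close> and \<open>\<epsilon>\<close>.\<close>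
  have E_ne: "\<sigma> * (\<integral>\<omega>. h (\<epsilon> \<omega>) \<partial>P) - R\<^sup>2 \<noteq> (\<integral>\<omega>. h (Y \<omega>) \<partial>P)"
  proof
    assume eq: "\<sigma> * (\<integral>\<omega>. h (\<epsilon> \<omega>) \<partial>P) - R\<^sup>2 = (\<integral>\<omega>. h (Y \<omega>) \<partial>P)"
    have "(\<integral>\<omega>. h (Y \<omega>) - (\<sigma> * h (\<epsilon> \<omega>) - R\<^sup>2) \<partial>P) = 0"
      using eq int_hY int_h\<epsilon> by (simp add: P.prob_space)
    then have "AE \<omega> in P. h (Y \<omega>) - (\<sigma> * h (\<epsilon> \<omega>) - R\<^sup>2) = 0"
      by (subst (asm) integral_nonneg_eq_0_iff_AE) (use int_hY int_h\<epsilon> shift in auto)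
    then have "AE \<omega> in P. h (\<epsilon> \<omega>) \<le> - (Z \<omega> \<bullet> \<epsilon> \<omega>)"
    proof (rule AE_mp, intro AE_I2 impI)
      fix \<omega> assume "\<omega> \<in> space P" "h (Y \<omega>) - (\<sigma> * h (\<epsilon> \<omega>) - R\<^sup>2) = 0"
      then show "h (\<epsilon> \<omega>) \<le> - (Z \<omega> \<bullet> \<epsilon> \<omega>)"
        unfolding h_def Y
        by (intro support_fun_shift_equality_case[OF C_bd ZC \<open>\<sigma> > 0\<close>]) auto
    qed
    then have "(\<integral>\<omega>. h (\<epsilon> \<omega>) \<partial>P) \<le> (\<integral>\<omega>. - (Z \<omega> \<bullet> \<epsilon> \<omega>) \<partial>P)"
      using int_h\<epsilon> int_Z\<epsilon> by (intro integral_mono_AE) auto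
    then show False using EZ\<epsilon> E_pos by simp
  qed

  define s where "s = (\<integral>\<omega>. h (Y \<omega>) \<partial>P) / x"
  define r where "r = (1 + sqrt (1 - a\<^sup>2 * (2 - A\<^sup>2))) / (2 - A\<^sup>2)"
  have q: "2 - A\<^sup>2 > 0"
    using power_strict_mono[OF assms(6), of 2] assms(4) by simp
  \<comment> \<open>As \<open>a \<le> A\<close>, the discriminant is at least \<open>(1 - A\<^sup>2)\<^sup>2\<close>.\<close>
  have disc: "1 - a\<^sup>2 * (2 - A\<^sup>2) \<ge> 0"
  proof -
    obtain z where "z \<in> C" using C_ne by blast
    then have "a * norm t0 \<le> A * norm t0" using C_bd'[of z] by (simp add: R_def)
    then have "a\<^sup>2 \<le> A\<^sup>2" using assms(2,3) by (intro power_mono) auto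
    then have "a\<^sup>2 * (2 - A\<^sup>2) \<le> A\<^sup>2 * (2 - A\<^sup>2)" using q by (intro mult_right_mono) auto
    also have "\<dots> \<le> 1" using zero_le_power2[of "1 - A\<^sup>2"] by (simp add: power2_eq_square algebra_simps)
    finally show ?thesis by simp
  qed
  have "s > r"
  proof -
    have "norm t0 * (A\<^sup>2 + r) \<le> \<sigma> * theta P G act \<epsilon> t0"
      using assms(16,17) by (simp add: r_def field_simps)
    then have "norm t0 * (A\<^sup>2 + r) * norm t0 \<le> \<sigma> * theta P G act \<epsilon> t0 * norm t0"
      by (rule mult_right_mono) simp
    then have "(A\<^sup>2 + r) * x \<le> \<sigma> * (\<integral>\<omega>. h (\<epsilon> \<omega>) \<partial>P)"
      by (simp add: theta x_def power2_eq_square mult_ac)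
    with E_ge E_ne \<open>R\<^sup>2 = A\<^sup>2 * x\<close> have "r * x < (\<integral>\<omega>. h (Y \<omega>) \<partial>P)" by (simp add: algebra_simps)
    then show ?thesis using \<open>x > 0\<close> by (simp add: s_def field_simps)
  qed
  then have s_root: "(2 - A\<^sup>2) * s\<^sup>2 - 2 * s + a\<^sup>2 > 0" and "s > 0"
    using beyond_larger_root[OF q disc r_def] by auto
  have EhY: "(\<integral>\<omega>. h (Y \<omega>) \<partial>P) = s * x" using \<open>x > 0\<close> by (simp add: s_def)

  let ?EY = "\<integral>\<omega>. (norm (Y \<omega>))\<^sup>2 \<partial>P"
  have orbit: "(INF g\<in>carrier G. (norm (act g (l *\<^sub>R t0) - y))\<^sup>2) = (INF z\<in>C. (norm (l *\<^sub>R z - y))\<^sup>2)" for l y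
    unfolding C_def image_image by (intro INF_cong refl) (simp add: linear_scale lin)
  have upper: "pre_variance P G act Y (s *\<^sub>R t0) \<le> ?EY + s\<^sup>2 * R\<^sup>2 - 2 * s * (s * x)"
  proof -
    have le: "(INF z\<in>C. (norm (s *\<^sub>R z - Y \<omega>))\<^sup>2) \<le> (norm (Y \<omega>))\<^sup>2 + s\<^sup>2 * R\<^sup>2 - 2 * s * h (Y \<omega>)" for \<omega>
      unfolding h_def using \<open>s > 0\<close> by (intro INF_dist_sq_scaled_le[OF C_bd C_ne]) auto
    \<comment> \<open>The bound is then nonnegative, and the comparison of integrals holds even for a
      non-integrable left-hand side, whose integral is 0 by default.\<close>
    have "0 \<le> (INF z\<in>C. (norm (s *\<^sub>R z - Y \<omega>))\<^sup>2)" for \<omega>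
      by (rule cINF_greatest[OF C_ne]) simp
    from order_trans[OF this le] have "pre_variance P G act Y (s *\<^sub>R t0)
        \<le> (\<integral>\<omega>. (norm (Y \<omega>))\<^sup>2 + s\<^sup>2 * R\<^sup>2 - 2 * s * h (Y \<omega>) \<partial>P)"
      unfolding pre_variance_def orbit
      using le int_hY assms(15) by (intro integral_mono') auto
    also have "\<dots> = ?EY + s\<^sup>2 * R\<^sup>2 - 2 * s * (s * x)"
      using int_hY assms(15) by (simp add: P.prob_space EhY)
    finally show ?thesis .
  qed
  have lower: "?EY + a\<^sup>2 * x - 2 * (s * x) \<le> pre_variance P G act Y t0"
  proof -
    let ?I = "\<lambda>\<omega>. INF z\<in>C. (norm (z - Y \<omega>))\<^sup>2"
    have le: "?I \<omega> \<le> (norm (Y \<omega>))\<^sup>2 + R\<^sup>2 - 2 * h (Y \<omega>)" for \<omega>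
      using INF_dist_sq_scaled_le[OF C_bd C_ne, of 1 "Y \<omega>"] by (simp add: h_def)
    have nonneg: "0 \<le> ?I \<omega>" for \<omega>
      by (rule cINF_greatest[OF C_ne]) simp
    have int_I: "integrable P ?I"
    proof (rule Bochner_Integration.integrable_bound)
      show "integrable P (\<lambda>\<omega>. (norm (Y \<omega>))\<^sup>2 + R\<^sup>2 - 2 * h (Y \<omega>))"
        using int_hY assms(15) by simp
      show "?I \<in> borel_measurable P"
        by (rule measurable_compose[OF _ borel_measurable_INF_dist_sq[OF C_ne]]) measurable
      show "AE \<omega> in P. norm (?I \<omega>) \<le> norm ((norm (Y \<omega>))\<^sup>2 + R\<^sup>2 - 2 * h (Y \<omega>))"
        using le nonneg by (intro AE_I2) (simp, meson abs_ge_self order_trans)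
    qed
    have "?EY + a\<^sup>2 * x - 2 * (s * x) = (\<integral>\<omega>. (norm (Y \<omega>))\<^sup>2 + (a * norm t0)\<^sup>2 - 2 * h (Y \<omega>) \<partial>P)"
      using int_hY assms(15) by (simp add: P.prob_space EhY x_def power_mult_distrib)
    also have "\<dots> \<le> (\<integral>\<omega>. ?I \<omega> \<partial>P)"
      using int_I int_hY assms(15)
      by (intro integral_mono)
        (auto simp: h_def intro!: INF_dist_sq_ge[OF C_bd' C_ne] mult_nonneg_nonneg assms(3))
    also have "\<dots> = pre_variance P G act Y t0"
      using orbit[of 1] by (simp add: pre_variance_def)
    finally show ?thesis .
  qed
  have "pre_variance P G act Y t0 \<le> pre_variance P G act Y (s *\<^sub>R t0)"
    using cons by (simp add: consistent_def)
  with upper lower have "a\<^sup>2 * x - 2 * (s * x) \<le> s\<^sup>2 * R\<^sup>2 - 2 * s * (s * x)" by linarith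
  then have "x * ((2 - A\<^sup>2) * s\<^sup>2 - 2 * s + a\<^sup>2) \<le> 0"
    unfolding \<open>R\<^sup>2 = A\<^sup>2 * x\<close> by (simp add: power2_eq_square algebra_simps)
  then show False using s_root \<open>x > 0\<close> by (simp add: mult_le_0_iff)
qed

end
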